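(* Let $\alpha\ge0$ and $r\in(0,1]$. For any $\delta,\kappa\in\mathbb R$ there is a constant $C=C(r,\alpha,d,\delta,\kappa)\geq 1$ such that for all $f$, $$C^{-1}\sup_{z\in\mathbb R^d}\big(\rho_\delta(z)\|\phi^z_rf\|_{\mathscr C^\alpha(\rho_\kappa)}\big)\le\|f\|_{\mathscr C^\alpha(\rho_\delta\rho_\kappa)}\le C\sup_{z\in\mathbb R^d}\big(\rho_\delta(z)\|\phi^z_rf\|_{\mathscr C^\alpha(\rho_\kappa)}\big).$$
   Context: $\rho_\delta(x)=(1+|x|^2)^{-\delta/2}$ on $\mathbb R^d$. For a weight $\rho$, $k\in\mathbb N_0$ and $a\in[0,1)$, the weighted Hölder space $\mathscr C^{k+a}(\rho)$ has norm $$\|f\|_{\mathscr C^{k+a}(\rho)}=\sum_{j=0}^k\|\nabla^j(\rho f)\|_{L^\infty}+\sup_{x\ne y}\frac{|\nabla^k(\rho f)(x)-\nabla^k(\rho f)(y)|}{|x-y|^a}$$ (for $a=0$ the last term is, up to equivalence of norms, redundant). Cutoffs: $\chi\in C_c^\infty(\mathbb R^d)$ is fixed with $\chi(x)=1$ for $|x|\le1/8$ and $\chi(x)=0$ for $|x|>1/4$, and $\phi^z_r(x)=\chi\big(\frac{x-z}{r(1+|z|)}\big)$. *)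

theory Defs
  imports "HOL-Analysis.Analysis" "HOL-Probability.Essential_Supremum"
begin

fun Ck :: "nat \<Rightarrow> ('a::euclidean_space \<Rightarrow> real) \<Rightarrow> bool" where
  "Ck 0 g \<longleftrightarrow> continuous_on UNIV g"
| "Ck (Suc k) g \<longleftrightarrow>
     (\<forall>x. g differentiable (at x)) \<and> (\<forall>v. Ck k (\<lambda>x. frechet_derivative g (at x) v))"

fun iter_partial :: "'a::euclidean_space list \<Rightarrow> ('a \<Rightarrow> real) \<Rightarrow> 'a \<Rightarrow> real" where
  "iter_partial [] g = g"
| "iter_partial (b # bs) g = (\<lambda>x. frechet_derivative (iter_partial bs g) (at x) b)"

text \<open>The tensor \<open>\<nabla>\<^sup>k g(x)\<close> is given by its entries \<open>iter_partial bs g x\<close>, indexed by the lists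
  \<open>bs\<close> of \<open>k\<close> basis vectors; its size is measured in the Euclidean (Frobenius) norm.\<close>

definition tensor_idx :: "nat \<Rightarrow> 'a::euclidean_space list set" where
  "tensor_idx k = {bs. length bs = k \<and> set bs \<subseteq> Basis}"

definition norm_nabla :: "nat \<Rightarrow> ('a::euclidean_space \<Rightarrow> real) \<Rightarrow> 'a \<Rightarrow> real" where
  "norm_nabla k g x = L2_set (\<lambda>bs. iter_partial bs g x) (tensor_idx k)"

definition dist_nabla :: "nat \<Rightarrow> ('a::euclidean_space \<Rightarrow> real) \<Rightarrow> 'a \<Rightarrow> 'a \<Rightarrow> real" where
  "dist_nabla k g x y = L2_set (\<lambda>bs. iter_partial bs g x - iter_partial bs g y) (tensor_idx k)"

text \<open>The Hoelder norm of order \<open>\<alpha> = k + a\<close> with \<open>k = \<lfloor>\<alpha>\<rfloor>\<close> and \<open>a \<in> [0,1)\<close>, with value \<open>\<infinity>\<close> for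
  functions outside the space. For \<open>a = 0\<close> the last term is kept and is the oscillation of
  \<open>\<nabla>\<^sup>k g\<close>, since \<open>t powr 0 = 1\<close> for \<open>t > 0\<close>.\<close>

definition holder_norm :: "real \<Rightarrow> ('a::euclidean_space \<Rightarrow> real) \<Rightarrow> ennreal" where
  "holder_norm \<alpha> g =
     (let k = nat \<lfloor>\<alpha>\<rfloor>; a = frac \<alpha> in
      if Ck k g then
        (\<Sum>j\<le>k. esssup lborel (\<lambda>x. ennreal (norm_nabla j g x))) +
        (SUP (x, y) \<in> {(x, y). x \<noteq> y}. ennreal (dist_nabla k g x y / norm (x - y) powr a))
      else \<infinity>)"

definition weighted_holder_norm ::
  "real \<Rightarrow> ('a::euclidean_space \<Rightarrow> real) \<Rightarrow> ('a \<Rightarrow> real) \<Rightarrow> ennreal" where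
  "weighted_holder_norm \<alpha> w f = holder_norm \<alpha> (\<lambda>x. w x * f x)"

definition weight :: "real \<Rightarrow> 'a::euclidean_space \<Rightarrow> real" where
  "weight \<delta> x = (1 + (norm x)\<^sup>2) powr (- \<delta> / 2)"

definition is_cutoff :: "('a::euclidean_space \<Rightarrow> real) \<Rightarrow> bool" where
  "is_cutoff \<eta> \<longleftrightarrow>
     (\<forall>k. Ck k \<eta>) \<and> compact (closure {x. \<eta> x \<noteq> 0}) \<and>
     (\<forall>x. norm x \<le> 1/8 \<longrightarrow> \<eta> x = 1) \<and> (\<forall>x. norm x > 1/4 \<longrightarrow> \<eta> x = 0)"

definition local_cutoff ::
  "('a::euclidean_space \<Rightarrow> real) \<Rightarrow> real \<Rightarrow> 'a \<Rightarrow> 'a \<Rightarrow> real" where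
  "local_cutoff \<eta> r z x = \<eta> ((x - z) /\<^sub>R (r * (1 + norm z)))"

end

theory Submission
  imports Defs
begin

text \<open>
  Write \<open>F = \<rho>\<^sub>\<delta> \<rho>\<^sub>\<kappa> f\<close> for the function whose norm is to be localised, \<open>\<phi>\<^sub>z\<close> for the cutoff
  \<open>local_cutoff \<eta> r z\<close> and \<open>G\<^sub>z = \<rho>\<^sub>\<kappa> \<phi>\<^sub>z f\<close> for the localised function. Up to
  the multiplier \<open>m = \<rho>\<^sub>\<delta>(z) \<phi>\<^sub>z \<rho>\<^sub>-\<^sub>\<delta>\<close>, which is smooth and of size one, \<open>F\<close> and \<open>\<rho>\<^sub>\<delta>(z) G\<^sub>z\<close>
  are the same function near \<open>z\<close>:

  \<^item> \<open>\<rho>\<^sub>\<delta>(z) G\<^sub>z = m F\<close> on the whole space, which gives the lower bound.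

  \<^item> For the upper bound, let \<open>m'\<close> be the multiplier built from the narrower cutoff
    \<open>\<psi>\<^sub>z = local_cutoff \<eta> (r/2) z\<close> and from \<open>-\<delta>\<close> in place of \<open>\<delta>\<close>. Since \<open>\<psi>\<^sub>z = \<phi>\<^sub>z = 1\<close> near \<open>z\<close>,
    the function \<open>m' (\<rho>\<^sub>\<delta>(z) G\<^sub>z)\<close> coincides with \<open>F\<close> on the ball of radius \<open>r/16\<close> around \<open>z\<close>. A
    function that agrees near every point, on balls of one fixed radius, with functions of
    uniformly bounded Hoelder norm is itself bounded in that norm (\<open>holder_bounded_local\<close>): pairs of
    points further apart than the radius are controlled by the supremum norm.

  Thus two facts carry the proof. Multiplication is continuous for Hoelder bounds
  (\<open>holder_bounded_mult\<close>), and the multipliers are bounded uniformly in \<open>z\<close>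
  (\<open>multiplier_holder_bounded\<close>). The latter holds because every derivative of \<open>\<rho>\<^sub>-\<^sub>\<delta>\<close> is dominated by
  \<open>\<rho>\<^sub>-\<^sub>\<delta>\<close> itself (\<open>dominated_weight\<close>), the support of \<open>\<phi>\<^sub>z\<close> has radius at most \<open>(1 + |z|)/4\<close>, and
  there \<open>\<rho>\<^sub>\<delta>(z) \<rho>\<^sub>-\<^sub>\<delta>\<close> is bounded (\<open>weight_ratio_le\<close>); the derivatives of \<open>\<phi>\<^sub>z\<close> stay bounded because
  the length \<open>r (1 + |z|)\<close> by which \<open>\<eta>\<close> is scaled is at least \<open>r\<close>.

  All estimates are made for predicates that recurse over the order of differentiation
  (\<open>dominated\<close>, \<open>holder_bounded\<close>), so that each of them is an induction whose step is a single
  product or chain rule. Up to a factor depending on \<open>\<alpha>\<close> and the dimension, \<open>holder_bounded\<close> is a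
  bound on the Hoelder norm; this includes the differentiability that decides whether the norm is
  finite.
\<close>

section \<open>Partial derivatives\<close>

abbreviation partial :: "'a::euclidean_space \<Rightarrow> ('a \<Rightarrow> real) \<Rightarrow> 'a \<Rightarrow> real" where
  "partial b g \<equiv> (\<lambda>x. frechet_derivative g (at x) b)"

lemma continuous_on_UNIV_differentiable:
  fixes g :: "'a::euclidean_space \<Rightarrow> real"
  assumes "\<And>x. g differentiable (at x)"
  shows "continuous_on UNIV g"
  using assms by (simp add: continuous_at_imp_continuous_on differentiable_imp_continuous_within)

lemma partial_add:
  assumes "\<And>x. g differentiable (at x)" "\<And>x. h differentiable (at x)"
  shows "partial b (\<lambda>x. g x + h x) = (\<lambda>x. partial b g x + partial b h x)"
proof
  fix x
  have "((\<lambda>x. g x + h x) has_derivative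
      (\<lambda>v. frechet_derivative g (at x) v + frechet_derivative h (at x) v)) (at x)"
    using assms by (intro has_derivative_add) (simp_all add: frechet_derivative_works[symmetric])
  from frechet_derivative_at[OF this]
  show "partial b (\<lambda>x. g x + h x) x = partial b g x + partial b h x" by metis
qed

lemma partial_mult:
  assumes "\<And>x. g differentiable (at x)" "\<And>x. h differentiable (at x)"
  shows "partial b (\<lambda>x. g x * h x) = (\<lambda>x. g x * partial b h x + partial b g x * h x)"
proof
  fix x
  have "((\<lambda>x. g x * h x) has_derivative
      (\<lambda>v. g x * frechet_derivative h (at x) v + frechet_derivative g (at x) v * h x)) (at x)"
    using assms by (intro has_derivative_mult) (simp_all add: frechet_derivative_works[symmetric])
  from frechet_derivative_at[OF this]
  show "partial b (\<lambda>x. g x * h x) x = g x * partial b h x + partial b g x * h x" by metis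
qed

lemma partial_cmult:
  assumes "\<And>x. g differentiable (at x)"
  shows "partial b (\<lambda>x. c * g x) = (\<lambda>x. c * partial b g x)"
  using partial_mult[of "\<lambda>_. c" g b] assms by (simp add: frechet_derivative_const)

lemma partial_cong_open:
  assumes "open S" "x \<in> S" "\<And>y. y \<in> S \<Longrightarrow> f y = g y" "f differentiable (at x)"
  shows "g differentiable (at x)" "partial b g x = partial b f x"
proof -
  have "(f has_derivative frechet_derivative f (at x)) (at x)"
    using assms by (simp add: frechet_derivative_works[symmetric])
  then have d: "(g has_derivative frechet_derivative f (at x)) (at x)"
    by (rule has_derivative_transform_within_open[OF _ assms(1,2)]) (use assms in auto)
  then show "g differentiable (at x)" by (auto simp: differentiable_def)
  from frechet_derivative_at[OF d] show "partial b g x = partial b f x" by metis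
qed

lemma frechet_derivative_expand:
  assumes "g differentiable (at x)"
  shows "frechet_derivative g (at x) v = (\<Sum>b\<in>Basis. (v \<bullet> b) * partial b g x)"
proof -
  have l: "linear (frechet_derivative g (at x))"
    using assms by (rule linear_frechet_derivative)
  have "frechet_derivative g (at x) v = frechet_derivative g (at x) (\<Sum>b\<in>Basis. (v \<bullet> b) *\<^sub>R b)"
    by (simp add: euclidean_representation)
  also have "\<dots> = (\<Sum>b\<in>Basis. (v \<bullet> b) * partial b g x)"
    by (simp add: linear_sum[OF l] linear_cmul[OF l])
  finally show ?thesis .
qed

section \<open>Functions whose derivatives are dominated by a weight\<close>

text \<open>All partial derivatives of \<open>g\<close> up to order \<open>k\<close> are bounded pointwise by \<open>K w\<close>. A variable
  bound \<open>w\<close> is what lets the growth of a weight be compared with the weight itself, and records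
  the support of a cutoff when \<open>w\<close> is an indicator.\<close>

fun dominated :: "nat \<Rightarrow> real \<Rightarrow> ('a::euclidean_space \<Rightarrow> real) \<Rightarrow> ('a \<Rightarrow> real) \<Rightarrow> bool" where
  "dominated 0 K w g \<longleftrightarrow> continuous_on UNIV g \<and> (\<forall>x. \<bar>g x\<bar> \<le> K * w x)"
| "dominated (Suc k) K w g \<longleftrightarrow>
     (\<forall>x. g differentiable (at x)) \<and> (\<forall>x. \<bar>g x\<bar> \<le> K * w x) \<and>
     (\<forall>b\<in>Basis. dominated k K w (partial b g))"

lemma dominated_mono:
  "dominated k K w g \<Longrightarrow> (\<And>x. K * w x \<le> K' * w' x) \<Longrightarrow> dominated k K' w' g"
  by (induction k arbitrary: g) (auto intro: order_trans)

lemma dominated_Suc_imp: "dominated (Suc k) K w g \<Longrightarrow> dominated k K w g"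
proof (induction k arbitrary: g)
  case 0
  then show ?case by (auto intro: continuous_on_UNIV_differentiable)
next
  case (Suc k)
  then show ?case by (metis dominated.simps(2))
qed

lemma dominated_add:
  "dominated k K w g \<Longrightarrow> dominated k L w h \<Longrightarrow> dominated k (K + L) w (\<lambda>x. g x + h x)"
proof (induction k arbitrary: g h)
  case 0
  then show ?case
    by (auto intro!: continuous_intros simp: distrib_right intro: order_trans[OF abs_triangle_ineq add_mono])
next
  case (Suc k)
  then show ?case
    by (auto simp: partial_add distrib_right intro: order_trans[OF abs_triangle_ineq add_mono])
qed

lemma dominated_cmult: "dominated k K w g \<Longrightarrow> dominated k (\<bar>c\<bar> * K) w (\<lambda>x. c * g x)"
proof (induction k arbitrary: g)
  case 0
  then show ?case by (auto intro!: continuous_intros simp: abs_mult mult.assoc mult_left_mono)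
next
  case (Suc k)
  then show ?case by (auto simp: partial_cmult abs_mult mult.assoc mult_left_mono)
qed

lemma dominated_const: "(\<And>x. \<bar>c\<bar> \<le> K * w x) \<Longrightarrow> dominated k K w (\<lambda>_. c)"
proof (induction k arbitrary: c)
  case 0
  then show ?case by auto
next
  case (Suc k)
  have "dominated k K w (\<lambda>_. 0)" using Suc by (metis abs_0 abs_ge_zero order_trans)
  with Suc show ?case by (auto simp: frechet_derivative_const)
qed

lemma dominated_abs_le: "dominated k K w g \<Longrightarrow> \<bar>g x\<bar> \<le> K * w x"
  by (cases k) auto

text \<open>The spare factor \<open>c\<close> makes room for the constants that grow with the order of
  differentiation.\<close>

lemma abs_mult_le:
  fixes p q A B :: real
  assumes "\<bar>p\<bar> \<le> A" "\<bar>q\<bar> \<le> B" "1 \<le> c"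
  shows "\<bar>p * q\<bar> \<le> c * (A * B)"
proof -
  have "\<bar>p * q\<bar> \<le> A * B" unfolding abs_mult using assms by (intro mult_mono) auto
  also have "\<dots> = 1 * (A * B)" by simp
  also have "\<dots> \<le> c * (A * B)" using assms by (intro mult_right_mono) auto
  finally show ?thesis .
qed

lemma dominated_mult:
  "dominated k K w g \<Longrightarrow> dominated k L v h \<Longrightarrow>
    dominated k (2 ^ k * (K * L)) (\<lambda>x. w x * v x) (\<lambda>x. g x * h x)"
proof (induction k arbitrary: g h)
  case 0
  then show ?case
    using abs_mult_le[of "g _" "K * w _" "h _" "L * v _" 1]
    by (auto intro!: continuous_intros simp: algebra_simps)
next
  case (Suc k)
  have "\<bar>g x * h x\<bar> \<le> 2 ^ Suc k * (K * L) * (w x * v x)" for x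
    using abs_mult_le[of "g x" "K * w x" "h x" "L * v x" "2 ^ Suc k"]
      Suc.prems[THEN dominated_abs_le] one_le_power[of "2::real" "Suc k"]
    by (simp del: power_Suc add: ac_simps)
  moreover have "dominated k (2 ^ Suc k * (K * L)) (\<lambda>x. w x * v x) (partial b (\<lambda>x. g x * h x))"
    if b: "b \<in> Basis" for b
  proof -
    have "dominated k (2 ^ k * (K * L) + 2 ^ k * (K * L)) (\<lambda>x. w x * v x)
       (\<lambda>x. g x * partial b h x + partial b g x * h x)"
      using Suc.prems b Suc.prems[THEN dominated_Suc_imp]
      by (intro dominated_add Suc.IH) auto
    moreover have "2 ^ k * (K * L) + 2 ^ k * (K * L) = 2 ^ Suc k * (K * L)" by simp
    ultimately show ?thesis using Suc.prems by (simp del: power_Suc add: partial_mult)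
  qed
  ultimately show ?case using Suc.prems by (auto intro: differentiable_mult)
qed

text \<open>Each derivative of the rescaled function brings down a factor \<open>s\<close>. Taking \<open>S \<ge> 1\<close> allows one
  constant \<open>S\<^sup>k\<close> for all orders up to \<open>k\<close>.\<close>

lemma dominated_rescale:
  assumes "0 \<le> s" "s \<le> S" "1 \<le> S"
  shows "dominated k K w g \<Longrightarrow>
    dominated k (S ^ k * K) (\<lambda>x. w (s *\<^sub>R (x - z))) (\<lambda>x. g (s *\<^sub>R (x - z)))"
proof (induction k arbitrary: g)
  case 0
  then show ?case
    by (auto intro!: continuous_on_compose2[of UNIV g] continuous_intros)
next
  case (Suc k)
  have gd: "(g has_derivative frechet_derivative g (at y)) (at y)" for y
    using Suc.prems by (simp add: frechet_derivative_works[symmetric])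
  have d: "((\<lambda>x. g (s *\<^sub>R (x - z))) has_derivative
      (\<lambda>v. frechet_derivative g (at (s *\<^sub>R (x - z))) (s *\<^sub>R v))) (at x)" for x
    by (rule has_derivative_compose[OF _ gd]) (auto intro!: derivative_eq_intros)
  have lin: "linear (frechet_derivative g (at y))" for y
    using Suc.prems by (simp add: linear_frechet_derivative)
  have p: "partial b (\<lambda>x. g (s *\<^sub>R (x - z))) = (\<lambda>x. s * partial b g (s *\<^sub>R (x - z)))" for b
  proof
    fix x
    show "partial b (\<lambda>x. g (s *\<^sub>R (x - z))) x = s * partial b g (s *\<^sub>R (x - z))"
      using fun_cong[OF frechet_derivative_at[OF d[of x]], of b] by (simp add: linear_cmul[OF lin])
  qed
  have nn: "0 \<le> K * w x" for x using dominated_abs_le[OF Suc.prems] by (rule order_trans[OF abs_ge_zero])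
  have "dominated k (S ^ Suc k * K) (\<lambda>x. w (s *\<^sub>R (x - z))) (partial b (\<lambda>x. g (s *\<^sub>R (x - z))))"
    if b: "b \<in> Basis" for b
    unfolding p
  proof (rule dominated_mono)
    show "dominated k (\<bar>s\<bar> * (S ^ k * K)) (\<lambda>x. w (s *\<^sub>R (x - z)))
      (\<lambda>x. s * partial b g (s *\<^sub>R (x - z)))"
      using b Suc.prems by (intro dominated_cmult Suc.IH) auto
    show "\<bar>s\<bar> * (S ^ k * K) * w (s *\<^sub>R (x - z)) \<le> S ^ Suc k * K * w (s *\<^sub>R (x - z))" for x
      using mult_right_mono[OF assms(2), of "S ^ k * (K * w (s *\<^sub>R (x - z)))"] nn assms
      by (simp add: mult.assoc)
  qed
  moreover have "\<bar>g y\<bar> \<le> S ^ Suc k * K * w y" for y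
    using dominated_abs_le[OF Suc.prems, of y] mult_right_mono[OF one_le_power[OF assms(3)], of "K * w y" "Suc k"] nn[of y]
    by (simp add: mult.assoc)
  ultimately show ?case using d by (auto simp: differentiable_def)
qed

section \<open>Hoelder bounds\<close>

text \<open>The Hoelder condition is imposed on the derivatives of order \<open>k\<close> only; for lower orders it
  follows from the bound on the next derivative (\<open>holder_bounded_Suc_imp\<close>). At \<open>x = y\<close> it holds
  trivially for every \<open>a\<close>, and for \<open>a = 0\<close> it does not imply continuity, which is therefore
  demanded separately.\<close>

fun holder_bounded :: "nat \<Rightarrow> real \<Rightarrow> real \<Rightarrow> ('a::euclidean_space \<Rightarrow> real) \<Rightarrow> bool" where
  "holder_bounded 0 a K g \<longleftrightarrow> continuous_on UNIV g \<and> (\<forall>x. \<bar>g x\<bar> \<le> K) \<and>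
     (\<forall>x y. \<bar>g x - g y\<bar> \<le> K * norm (x - y) powr a)"
| "holder_bounded (Suc k) a K g \<longleftrightarrow>
     (\<forall>x. g differentiable (at x)) \<and> (\<forall>x. \<bar>g x\<bar> \<le> K) \<and>
     (\<forall>b\<in>Basis. holder_bounded k a K (partial b g))"

lemma abs_diff_le_of_partial_le:
  fixes g :: "'a::euclidean_space \<Rightarrow> real"
  assumes "\<And>x. g differentiable (at x)" "\<And>b x. b \<in> Basis \<Longrightarrow> \<bar>partial b g x\<bar> \<le> K"
  shows "\<bar>g x - g y\<bar> \<le> real DIM('a) * K * norm (x - y)"
proof -
  have "onorm (frechet_derivative g (at u)) \<le> real DIM('a) * K" for u
  proof (rule onorm_le)
    fix v :: 'a
    have "norm (frechet_derivative g (at u) v) \<le> (\<Sum>b\<in>(Basis::'a set). \<bar>(v \<bullet> b) * partial b g u\<bar>)"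
      by (subst frechet_derivative_expand[OF assms(1)]) (simp only: real_norm_def sum_abs)
    also have "\<dots> \<le> (\<Sum>b\<in>(Basis::'a set). norm v * K)"
      unfolding abs_mult using assms(2) by (intro sum_mono mult_mono Basis_le_norm) auto
    finally show "norm (frechet_derivative g (at u) v) \<le> real DIM('a) * K * norm v" by (simp add: algebra_simps)
  qed
  then have "norm (g x - g y) \<le> real DIM('a) * K * norm (x - y)"
    using assms(1) by (intro differentiable_bound[of UNIV g "\<lambda>u. frechet_derivative g (at u)"])
      (auto simp: frechet_derivative_works[symmetric])
  then show ?thesis by simp
qed

text \<open>A bounded Lipschitz function is Hoelder: \<open>t \<le> t\<^sup>a\<close> for \<open>t \<le> 1\<close>, and \<open>1 \<le> t\<^sup>a\<close> otherwise.\<close>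

lemma lipschitz_bounded_imp_holder:
  fixes D K a t u :: real
  assumes "\<bar>u\<bar> \<le> 2 * K" "\<bar>u\<bar> \<le> D * K * t" "0 \<le> t" "0 \<le> K" "0 \<le> D" "0 \<le> a" "a \<le> 1"
  shows "\<bar>u\<bar> \<le> (D + 2) * K * t powr a"
proof (cases "t \<ge> 1")
  case True
  have "\<bar>u\<bar> \<le> (D + 2) * K * 1" using assms(1) mult_nonneg_nonneg[OF assms(5,4)] by (simp add: algebra_simps)
  also have "\<dots> \<le> (D + 2) * K * t powr a"
    using True assms by (intro mult_left_mono ge_one_powr_ge_zero) auto
  finally show ?thesis .
next
  case False
  have "t \<le> t powr a" using False assms powr_mono'[of a 1 t] by (cases "t = 0") auto
  then have "D * K * t \<le> (D + 2) * K * t powr a"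
    using assms by (intro mult_mono) auto
  then show ?thesis using assms by linarith
qed

lemma holder_bounded_abs_le: "holder_bounded k a K g \<Longrightarrow> \<bar>g x\<bar> \<le> K"
  by (cases k) auto

lemma holder_bounded_nonneg: "holder_bounded k a K g \<Longrightarrow> 0 \<le> K"
  using holder_bounded_abs_le by (metis abs_ge_zero order_trans)

lemma holder_bounded_Suc_imp:
  fixes g :: "'a::euclidean_space \<Rightarrow> real"
  assumes "0 \<le> a" "a \<le> 1"
  shows "holder_bounded (Suc k) a K g \<Longrightarrow> holder_bounded k a ((real DIM('a) + 2) * K) g"
proof (induction k arbitrary: g)
  case 0
  have K: "0 \<le> K" using 0 by (rule holder_bounded_nonneg)
  have ge: "K \<le> (real DIM('a) + 2) * K" using mult_right_mono[of 1 "real DIM('a) + 2" K] K by simp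
  have "\<bar>g x - g y\<bar> \<le> (real DIM('a) + 2) * K * norm (x - y) powr a" for x y
  proof (rule lipschitz_bounded_imp_holder)
    show "\<bar>g x - g y\<bar> \<le> 2 * K"
      using holder_bounded_abs_le[OF 0, of x] holder_bounded_abs_le[OF 0, of y] by linarith
    show "\<bar>g x - g y\<bar> \<le> real DIM('a) * K * norm (x - y)"
      using 0 by (intro abs_diff_le_of_partial_le) auto
  qed (use K assms in auto)
  moreover have "\<bar>g x\<bar> \<le> (real DIM('a) + 2) * K" for x
    using holder_bounded_abs_le[OF 0, of x] ge by (rule order_trans)
  ultimately show ?case using 0 by (auto intro!: continuous_on_UNIV_differentiable)
next
  case (Suc k)
  have K: "0 \<le> K" using Suc.prems by (rule holder_bounded_nonneg)
  have ge: "K \<le> (real DIM('a) + 2) * K" using mult_right_mono[of 1 "real DIM('a) + 2" K] K by simp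
  have "\<bar>g x\<bar> \<le> (real DIM('a) + 2) * K" for x
    using holder_bounded_abs_le[OF Suc.prems, of x] ge by (rule order_trans)
  moreover have "holder_bounded k a ((real DIM('a) + 2) * K) (partial b g)" if "b \<in> Basis" for b
    using Suc.prems that by (intro Suc.IH) simp
  moreover have "\<forall>x. g differentiable (at x)" using Suc.prems by simp
  ultimately show ?case unfolding holder_bounded.simps(2) by blast
qed

text \<open>One derivative more than the order \<open>k\<close> pays for the Hoelder condition with any \<open>a \<le> 1\<close>.\<close>

lemma dominated_imp_holder_bounded:
  fixes g :: "'a::euclidean_space \<Rightarrow> real"
  assumes "0 \<le> a" "a \<le> 1"
  shows "dominated (Suc k) K (\<lambda>_. 1) g \<Longrightarrow> holder_bounded k a ((real DIM('a) + 2) * K) g"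
proof (induction k arbitrary: g)
  case 0
  have g: "\<bar>g x\<bar> \<le> K" for x using dominated_abs_le[OF 0] by simp
  then have K: "0 \<le> K" by (rule order_trans[OF abs_ge_zero])
  have ge: "K \<le> (real DIM('a) + 2) * K" using mult_right_mono[of 1 "real DIM('a) + 2" K] K by simp
  have "\<bar>g x - g y\<bar> \<le> (real DIM('a) + 2) * K * norm (x - y) powr a" for x y
  proof (rule lipschitz_bounded_imp_holder)
    show "\<bar>g x - g y\<bar> \<le> 2 * K" using g[of x] g[of y] by linarith
    show "\<bar>g x - g y\<bar> \<le> real DIM('a) * K * norm (x - y)"
      using 0 by (intro abs_diff_le_of_partial_le) auto
  qed (use K assms in auto)
  moreover have "\<bar>g x\<bar> \<le> (real DIM('a) + 2) * K" for x
    using g[of x] ge by (rule order_trans)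
  ultimately show ?case using 0 by (auto intro!: continuous_on_UNIV_differentiable)
next
  case (Suc k)
  have g: "\<bar>g x\<bar> \<le> K" for x using dominated_abs_le[OF Suc.prems] by simp
  then have K: "0 \<le> K" by (rule order_trans[OF abs_ge_zero])
  have ge: "K \<le> (real DIM('a) + 2) * K" using mult_right_mono[of 1 "real DIM('a) + 2" K] K by simp
  have "\<bar>g x\<bar> \<le> (real DIM('a) + 2) * K" for x
    using g[of x] ge by (rule order_trans)
  moreover have "holder_bounded k a ((real DIM('a) + 2) * K) (partial b g)" if "b \<in> Basis" for b
    using Suc.prems that by (intro Suc.IH) simp
  moreover have "\<forall>x. g differentiable (at x)" using Suc.prems by simp
  ultimately show ?case unfolding holder_bounded.simps(2) by blast
qed


lemma holder_bounded_add:
  "holder_bounded k a K g \<Longrightarrow> holder_bounded k a L h \<Longrightarrow>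
    holder_bounded k a (K + L) (\<lambda>x. g x + h x)"
proof (induction k arbitrary: g h)
  case 0
  have "\<bar>(g x + h x) - (g y + h y)\<bar> \<le> (K + L) * norm (x - y) powr a" for x y
  proof -
    have "\<bar>(g x + h x) - (g y + h y)\<bar> \<le> \<bar>g x - g y\<bar> + \<bar>h x - h y\<bar>" by arith
    also have "\<dots> \<le> (K + L) * norm (x - y) powr a"
      unfolding distrib_right using 0 by (intro add_mono) auto
    finally show ?thesis .
  qed
  moreover have "\<bar>g x + h x\<bar> \<le> K + L" for x
    using 0[THEN holder_bounded_abs_le, of x] by linarith
  ultimately show ?case using 0 by (auto intro!: continuous_intros)
next
  case (Suc k)
  have "\<bar>g x + h x\<bar> \<le> K + L" for x
    using Suc.prems[THEN holder_bounded_abs_le, of x] by linarith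
  then show ?case using Suc by (auto simp: partial_add)
qed

lemma holder_bounded_cmult:
  "holder_bounded k a K g \<Longrightarrow> holder_bounded k a (\<bar>c\<bar> * K) (\<lambda>x. c * g x)"
proof (induction k arbitrary: g)
  case 0
  have "\<bar>c * g x - c * g y\<bar> \<le> \<bar>c\<bar> * K * norm (x - y) powr a" for x y
  proof -
    have "\<bar>c * g x - c * g y\<bar> = \<bar>c\<bar> * \<bar>g x - g y\<bar>" by (simp add: abs_mult[symmetric] algebra_simps)
    also have "\<dots> \<le> \<bar>c\<bar> * (K * norm (x - y) powr a)" using 0 by (intro mult_left_mono) auto
    finally show ?thesis by (simp add: mult.assoc)
  qed
  with 0 show ?case by (auto intro!: continuous_intros simp: abs_mult mult_left_mono)
next
  case (Suc k)
  then show ?case by (auto simp: partial_cmult abs_mult mult_left_mono)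
qed

text \<open>In the product rule for \<open>g h\<close> the factors \<open>g\<close> and \<open>h\<close> themselves are needed at one order
  less than assumed. Lowering the order costs the factor \<open>d + 2\<close>, where \<open>d\<close> is the dimension, and
  the two summands of the product rule cost a factor 2; hence the constant.\<close>

lemma holder_bounded_mult:
  fixes g h :: "'a::euclidean_space \<Rightarrow> real"
  assumes a: "0 \<le> a" "a \<le> 1"
  shows "holder_bounded k a K g \<Longrightarrow> holder_bounded k a L h \<Longrightarrow>
    holder_bounded k a (2 * (2 * (real DIM('a) + 2)) ^ k * (K * L)) (\<lambda>x. g x * h x)"
proof (induction k arbitrary: g h K L)
  case 0
  have "\<bar>g x * h x - g y * h y\<bar> \<le> 2 * (K * L) * norm (x - y) powr a" for x y
  proof -
    have "g x * h x - g y * h y = g x * (h x - h y) + (g x - g y) * h y" by (simp add: algebra_simps)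
    then have "\<bar>g x * h x - g y * h y\<bar> \<le> \<bar>g x * (h x - h y)\<bar> + \<bar>(g x - g y) * h y\<bar>"
      by (metis abs_triangle_ineq)
    also have "\<dots> \<le> 1 * (K * (L * norm (x - y) powr a)) + 1 * ((K * norm (x - y) powr a) * L)"
      using 0 by (intro add_mono abs_mult_le) auto
    finally show ?thesis by (simp add: algebra_simps)
  qed
  moreover have "\<bar>g x * h x\<bar> \<le> 2 * (K * L)" for x
    using 0 by (intro abs_mult_le) auto
  ultimately show ?case using 0 by (auto intro!: continuous_intros)
next
  case (Suc k)
  define D where "D = real DIM('a) + 2"
  define M where "M = 2 * (2 * D) ^ k"
  have D1: "1 \<le> D" by (simp add: D_def)
  have M: "2 * (2 * D) ^ Suc k = 2 * D * M" by (simp add: M_def)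
  have "\<bar>g x * h x\<bar> \<le> 2 * (2 * D) ^ Suc k * (K * L)" for x
  proof (rule abs_mult_le)
    have "1 \<le> (2 * D) ^ Suc k" using D1 by (intro one_le_power) auto
    then show "1 \<le> 2 * (2 * D) ^ Suc k" by linarith
  qed (use Suc.prems in auto)
  moreover have "holder_bounded k a (2 * (2 * D) ^ Suc k * (K * L)) (partial b (\<lambda>x. g x * h x))"
    if b: "b \<in> Basis" for b
  proof -
    have "holder_bounded k a (M * (D * K * L)) (\<lambda>x. g x * partial b h x)"
      unfolding M_def D_def using Suc.prems b
      by (intro Suc.IH holder_bounded_Suc_imp[OF a]) auto
    moreover have "holder_bounded k a (M * (K * (D * L))) (\<lambda>x. partial b g x * h x)"
      unfolding M_def D_def using Suc.prems b
      by (intro Suc.IH holder_bounded_Suc_imp[OF a]) auto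
    ultimately have "holder_bounded k a (M * (D * K * L) + M * (K * (D * L)))
      (\<lambda>x. g x * partial b h x + partial b g x * h x)"
      by (rule holder_bounded_add)
    moreover have "M * (D * K * L) + M * (K * (D * L)) = 2 * (2 * D) ^ Suc k * (K * L)"
      unfolding M by (simp add: algebra_simps)
    ultimately show ?thesis using Suc.prems by (simp del: power_Suc add: partial_mult)
  qed
  ultimately show ?case using Suc.prems unfolding D_def by (auto intro: differentiable_mult)
qed

text \<open>Derivatives are local, so only the Hoelder quotient at distance at least \<open>c\<close> needs an argument:
  there it is at most \<open>2 K / c\<^sup>a\<close>.\<close>

lemma holder_bounded_local:
  fixes g :: "'a::euclidean_space \<Rightarrow> real"
  assumes a: "0 \<le> a" and c: "0 < c"
  shows "(\<And>z. \<exists>G. holder_bounded k a K G \<and> (\<forall>x\<in>ball z c. G x = g x)) \<Longrightarrow>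
    holder_bounded k a ((1 + 2 / c powr a) * K) g"
proof (induction k arbitrary: g)
  case 0
  have g: "\<bar>g x\<bar> \<le> K" for x using 0[of x] c by (metis centre_in_ball holder_bounded_abs_le)
  then have K: "0 \<le> K" by (rule order_trans[OF abs_ge_zero])
  have ge: "K \<le> (1 + 2 / c powr a) * K" using K by (simp add: distrib_right)
  have "isCont g x" for x
  proof -
    from 0 obtain G where G: "holder_bounded 0 a K G" "\<And>y. y \<in> ball x c \<Longrightarrow> G y = g y" by blast
    have "continuous_on (ball x c) G" using G(1) by (auto intro: continuous_on_subset)
    then have "continuous_on (ball x c) g" using G(2) by (rule continuous_on_eq)
    then show ?thesis using c by (simp add: continuous_on_eq_continuous_at)
  qed
  then have "continuous_on UNIV g" by (simp add: continuous_at_imp_continuous_on)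
  moreover have "\<bar>g x - g y\<bar> \<le> (1 + 2 / c powr a) * K * norm (x - y) powr a" for x y
  proof (cases "norm (x - y) < c")
    case True
    from 0 obtain G where G: "holder_bounded 0 a K G" "\<And>y. y \<in> ball x c \<Longrightarrow> G y = g y" by blast
    have "\<bar>g x - g y\<bar> = \<bar>G x - G y\<bar>" using G(2) True c by (simp add: dist_norm)
    also have "\<dots> \<le> K * norm (x - y) powr a" using G(1) by simp
    also have "\<dots> \<le> (1 + 2 / c powr a) * K * norm (x - y) powr a" using ge by (intro mult_right_mono) auto
    finally show ?thesis .
  next
    case False
    have "\<bar>g x - g y\<bar> \<le> 2 * K" using g[of x] g[of y] by linarith
    also have "\<dots> = 2 / c powr a * K * c powr a" using c by simp
    also have "\<dots> \<le> (1 + 2 / c powr a) * K * norm (x - y) powr a"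
      using False a c K by (intro mult_mono powr_mono2) auto
    finally show ?thesis .
  qed
  moreover have "\<bar>g x\<bar> \<le> (1 + 2 / c powr a) * K" for x using g[of x] ge by linarith
  ultimately show ?case by simp
next
  case (Suc k)
  have g: "\<bar>g x\<bar> \<le> K" for x using Suc.prems[of x] c by (metis centre_in_ball holder_bounded_abs_le)
  then have K: "0 \<le> K" by (rule order_trans[OF abs_ge_zero])
  have ge: "K \<le> (1 + 2 / c powr a) * K" using K by (simp add: distrib_right)
  have "g differentiable (at x)" for x
  proof -
    from Suc.prems obtain G where G: "holder_bounded (Suc k) a K G" "\<And>y. y \<in> ball x c \<Longrightarrow> G y = g y" by blast
    show ?thesis by (rule partial_cong_open(1)[of "ball x c" x G]) (use G c in auto)
  qed
  moreover have "holder_bounded k a ((1 + 2 / c powr a) * K) (partial b g)" if b: "b \<in> Basis" for b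
  proof (rule Suc.IH)
    fix z
    from Suc.prems obtain G where G: "holder_bounded (Suc k) a K G" "\<And>y. y \<in> ball z c \<Longrightarrow> G y = g y" by blast
    have "partial b G x = partial b g x" if "x \<in> ball z c" for x
      by (rule partial_cong_open(2)[of "ball z c" x G, symmetric]) (use G that in auto)
    then show "\<exists>G. holder_bounded k a K G \<and> (\<forall>x\<in>ball z c. G x = partial b g x)"
      using G(1) b by auto
  qed
  moreover have "\<bar>g x\<bar> \<le> (1 + 2 / c powr a) * K" for x using g[of x] ge by linarith
  ultimately show ?case by simp
qed


section \<open>Polynomial weights\<close>

lemma weight_pos: "0 < weight \<delta> x"
  by (simp add: weight_def add_pos_nonneg less_imp_neq[symmetric])

lemma weight_mult: "weight \<gamma> x * weight \<delta> x = weight (\<gamma> + \<delta>) x"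
  by (simp add: weight_def powr_add[symmetric] diff_divide_distrib)

lemma weight_zero: "weight 0 x = 1"
  by (simp add: weight_def add_nonneg_eq_0_iff)

lemma weight_antimono: "\<gamma> \<le> \<delta> \<Longrightarrow> weight \<delta> x \<le> weight \<gamma> x"
  unfolding weight_def by (intro powr_mono) auto

lemma norm_le_weight: "norm x \<le> weight (-1) x"
proof -
  have "norm x \<le> sqrt (1 + (norm x)\<^sup>2)" by (rule real_le_rsqrt) simp
  then show ?thesis by (simp add: weight_def powr_half_sqrt)
qed

lemma weight_has_derivative:
  fixes x :: "'a::euclidean_space"
  shows "(weight \<gamma> has_derivative (\<lambda>h. - \<gamma> * ((x \<bullet> h) * weight (\<gamma> + 2) x))) (at x)"
proof -
  have pos: "0 < 1 + y \<bullet> y" for y :: 'a by (simp add: add_pos_nonneg)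
  have eq: "- (\<gamma> + 2) / 2 = - \<gamma> / 2 - 1" by simp
  have w: "weight \<gamma> = (\<lambda>y::'a. (1 + y \<bullet> y) powr (- \<gamma> / 2))" for \<gamma>
    unfolding fun_eq_iff weight_def power2_norm_eq_inner by (rule allI) (rule refl)
  have "weight (\<gamma> + 2) x = (1 + x \<bullet> x) powr (- \<gamma> / 2) * inverse (1 + x \<bullet> x)"
    unfolding w[of "\<gamma> + 2"] eq powr_diff powr_one[OF less_imp_le[OF pos[of x]]]
    by (rule divide_inverse)
  moreover have "((\<lambda>y. (1 + y \<bullet> y) powr (- \<gamma> / 2)) has_derivative
      (\<lambda>h. (1 + x \<bullet> x) powr (- \<gamma> / 2) * ((x \<bullet> h + h \<bullet> x) * (- \<gamma> / 2) / (1 + x \<bullet> x)))) (at x)"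
    using pos[of x] by (auto intro!: derivative_eq_intros)
  moreover have "(1 + x \<bullet> x) powr (- \<gamma> / 2) * ((x \<bullet> h + h \<bullet> x) * (- \<gamma> / 2) / (1 + x \<bullet> x))
      = - \<gamma> * ((x \<bullet> h) * ((1 + x \<bullet> x) powr (- \<gamma> / 2) * inverse (1 + x \<bullet> x)))" for h
    by (simp add: inner_commute[of h x] divide_inverse[of _ "1 + x \<bullet> x"])
  ultimately show ?thesis unfolding w by (simp only:)
qed

lemma partial_weight: "partial b (weight \<gamma>) = (\<lambda>x. - \<gamma> * ((x \<bullet> b) * weight (\<gamma> + 2) x))"
proof
  fix x
  show "partial b (weight \<gamma>) x = - \<gamma> * ((x \<bullet> b) * weight (\<gamma> + 2) x)"
    using fun_cong[OF frechet_derivative_at[OF weight_has_derivative[of \<gamma> x]], of b] by simp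
qed

lemma weight_differentiable: "weight \<gamma> differentiable (at x)"
  using weight_has_derivative by (auto simp: differentiable_def)

lemma dominated_inner:
  fixes b :: "'a::euclidean_space"
  assumes b: "b \<in> Basis"
  shows "dominated k 1 (weight (-1)) (\<lambda>x. x \<bullet> b)"
proof -
  have le: "\<bar>x \<bullet> b\<bar> \<le> weight (-1) x" for x
    using Basis_le_norm[OF b, of x] norm_le_weight[of x] by linarith
  show ?thesis
  proof (cases k)
    case 0
    then show ?thesis using le by (auto intro!: continuous_intros)
  next
    case (Suc l)
    have d: "((\<lambda>x. x \<bullet> b) has_derivative (\<lambda>h. h \<bullet> b)) (at x)" for x
      by (auto intro!: derivative_eq_intros)
    have p: "partial c (\<lambda>x. x \<bullet> b) = (\<lambda>_. c \<bullet> b)" for c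
      using fun_cong[OF frechet_derivative_at[OF d], of c] by (auto simp: fun_eq_iff)
    have "dominated l 1 (weight (-1)) (\<lambda>_::'a. c \<bullet> b)" if "c \<in> Basis" for c
    proof (rule dominated_const)
      fix x :: 'a
      have "\<bar>c \<bullet> b\<bar> \<le> 1" using b that by (simp add: inner_Basis)
      also have "1 \<le> weight (-1) x" using weight_antimono[of "-1" 0 x] by (simp add: weight_zero)
      finally show "\<bar>c \<bullet> b\<bar> \<le> 1 * weight (-1) x" by simp
    qed
    with d le Suc show ?thesis by (auto simp: p differentiable_def)
  qed
qed

text \<open>Each first derivative of \<open>\<rho>\<^sub>\<gamma>\<close> is, up to a constant, \<open>(x \<bullet> b) \<rho>\<^sub>\<gamma>\<^sub>+\<^sub>2\<close>. The linear factor and all its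
  derivatives are dominated by \<open>\<rho>\<^sub>-\<^sub>1\<close>, so by induction, for all \<open>\<gamma>\<close> at once, the product is
  dominated by \<open>\<rho>\<^sub>\<gamma>\<^sub>+\<^sub>1 \<le> \<rho>\<^sub>\<gamma>\<close>.\<close>

lemma dominated_weight: "\<exists>K. dominated k K (weight \<gamma>) (weight \<gamma> :: 'a::euclidean_space \<Rightarrow> real)"
proof (induction k arbitrary: \<gamma>)
  case 0
  have "dominated 0 1 (weight \<gamma>) (weight \<gamma> :: 'a \<Rightarrow> real)"
    using weight_pos[of \<gamma>] by (auto intro!: continuous_on_UNIV_differentiable weight_differentiable less_imp_le)
  then show ?case ..
next
  case (Suc k)
  obtain K where K: "dominated k K (weight (\<gamma> + 2)) (weight (\<gamma> + 2) :: 'a \<Rightarrow> real)"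
    using Suc.IH by blast
  have "0 \<le> K * weight (\<gamma> + 2) (0::'a)" using dominated_abs_le[OF K] by (rule order_trans[OF abs_ge_zero])
  then have K0: "0 \<le> K" using weight_pos[of "\<gamma> + 2" "0::'a"] by (simp add: zero_le_mult_iff)
  define M where "M = \<bar>- \<gamma>\<bar> * (2 ^ k * (1 * K))"
  have M0: "0 \<le> M" using K0 by (simp add: M_def)
  have "dominated k (1 + M) (weight \<gamma>) (partial b (weight \<gamma> :: 'a \<Rightarrow> real))" if b: "b \<in> Basis" for b
    unfolding partial_weight
  proof (rule dominated_mono)
    show "dominated k M (\<lambda>x. weight (-1) x * weight (\<gamma> + 2) x)
        (\<lambda>x. - \<gamma> * ((x \<bullet> b) * weight (\<gamma> + 2) x))"
      unfolding M_def by (intro dominated_cmult dominated_mult dominated_inner b K)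
    show "M * (weight (-1) x * weight (\<gamma> + 2) x) \<le> (1 + M) * weight \<gamma> x" for x :: 'a
      using M0 weight_antimono[of \<gamma> "\<gamma> + 1" x] weight_pos[of \<gamma> x]
      by (intro mult_mono) (auto simp: weight_mult less_imp_le add.commute intro: less_imp_le[OF weight_pos])
  qed
  moreover have "\<bar>weight \<gamma> x\<bar> \<le> (1 + M) * weight \<gamma> x" for x :: 'a
    using M0 weight_pos[of \<gamma> x] by (simp add: distrib_right)
  ultimately have "dominated (Suc k) (1 + M) (weight \<gamma>) (weight \<gamma> :: 'a \<Rightarrow> real)"
    by (simp add: weight_differentiable)
  then show ?case ..
qed

text \<open>For \<open>|x - z| \<le> (1 + |z|)/4\<close> the triangle inequality gives \<open>|x| \<le> 4/3 |z| + 1/3\<close> and the same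
  with \<open>x\<close> and \<open>z\<close> exchanged, so that \<open>1 + |x|\<^sup>2\<close> and \<open>1 + |z|\<^sup>2\<close> differ by a factor of at most 4.\<close>

lemma weight_ratio_le:
  fixes x z :: "'a::euclidean_space"
  assumes "norm (x - z) \<le> (1 + norm z) / 4"
  shows "weight \<delta> z * weight (- \<delta>) x \<le> 4 powr \<bar>\<delta> / 2\<bar>"
proof -
  define A B where "A = 1 + (norm x)\<^sup>2" and "B = 1 + (norm z)\<^sup>2"
  have A: "0 < A" and B: "0 < B" by (auto simp: A_def B_def add_pos_nonneg)
  have sq: "4 * (1 + s\<^sup>2) - (1 + t\<^sup>2) \<ge> 0" if "0 \<le> t" "t \<le> 4 / 3 * s + 1 / 3" for s t :: real
  proof -
    have "t\<^sup>2 \<le> (4 / 3 * s + 1 / 3)\<^sup>2" using that by (intro power_mono) auto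
    moreover have "4 * (1 + s\<^sup>2) - 1 - (4 / 3 * s + 1 / 3)\<^sup>2 = 20 / 9 * (s - 1 / 5)\<^sup>2 + 14 / 5"
      by (simp add: power2_eq_square field_simps)
    moreover have "0 \<le> 20 / 9 * (s - 1 / 5)\<^sup>2" by simp
    ultimately show ?thesis by linarith
  qed
  have "norm x \<le> norm z + norm (x - z)" by norm
  then have "norm x \<le> 5 / 4 * norm z + 1 / 4" using assms by (simp add: add_divide_distrib)
  also have "\<dots> \<le> 4 / 3 * norm z + 1 / 3" by (intro add_mono mult_right_mono) auto
  finally have "norm x \<le> 4 / 3 * norm z + 1 / 3" .
  then have AB: "A \<le> 4 * B" using sq[of "norm x" "norm z"] by (simp add: A_def B_def)
  have "norm z \<le> norm x + norm (x - z)" by norm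
  then have "norm z \<le> 4 / 3 * norm x + 1 / 3" using assms by (simp add: field_simps)
  then have BA: "B \<le> 4 * A" using sq[of "norm z" "norm x"] by (simp add: A_def B_def)
  have eq: "weight \<delta> z * weight (- \<delta>) x = B powr (- \<delta> / 2) * A powr (\<delta> / 2)"
    by (simp add: weight_def A_def B_def)
  show ?thesis
  proof (cases "0 \<le> \<delta>")
    case True
    have "B powr (- \<delta> / 2) * A powr (\<delta> / 2) \<le> B powr (- \<delta> / 2) * (4 * B) powr (\<delta> / 2)"
      using True A AB by (intro mult_left_mono powr_mono2) auto
    also have "\<dots> = 4 powr (\<delta> / 2) * B powr (- \<delta> / 2 + \<delta> / 2)"
      unfolding powr_add using B by (simp add: powr_mult)
    finally show ?thesis using True B eq by simp
  next
    case False
    have "B powr (- \<delta> / 2) * A powr (\<delta> / 2) \<le> (4 * A) powr (- \<delta> / 2) * A powr (\<delta> / 2)"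
      using False B BA by (intro mult_right_mono powr_mono2) auto
    also have "\<dots> = 4 powr (- \<delta> / 2) * A powr (- \<delta> / 2 + \<delta> / 2)"
      unfolding powr_add using A by (simp add: powr_mult)
    finally show ?thesis using False A eq by simp
  qed
qed

section \<open>Uniform bounds for the localising multipliers\<close>

lemma Ck_imp_continuous: "Ck k g \<Longrightarrow> continuous_on UNIV g"
  by (cases k) (auto intro: continuous_on_UNIV_differentiable)

lemma compact_support_bounded:
  fixes g :: "'a::euclidean_space \<Rightarrow> real"
  assumes "continuous_on UNIV g" "\<And>x. R < norm x \<Longrightarrow> g x = 0"
  shows "\<exists>K\<ge>0. \<forall>x. \<bar>g x\<bar> \<le> K * indicator (cball 0 R) x"
proof -
  have "bounded (g ` cball 0 R)"
    using assms(1) by (intro compact_imp_bounded compact_continuous_image) (auto intro: continuous_on_subset)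
  then obtain K where K: "\<forall>x\<in>cball 0 R. \<bar>g x\<bar> \<le> K" by (auto simp: bounded_iff)
  have "\<bar>g x\<bar> \<le> max 0 K * indicator (cball 0 R) x" for x
  proof (cases "norm x \<le> R")
    case True
    then have "\<bar>g x\<bar> \<le> K" using K by simp
    with True show ?thesis by (simp add: le_max_iff_disj)
  next
    case False
    with assms(2)[of x] show ?thesis by simp
  qed
  then show ?thesis by (intro exI[of _ "max 0 K"]) auto
qed

text \<open>The derivatives of \<open>g\<close> vanish wherever \<open>g\<close> does on an open set, so each of them is again
  continuous with support in the same ball.\<close>

lemma Ck_compact_support_dominated:
  fixes g :: "'a::euclidean_space \<Rightarrow> real"
  shows "Ck k g \<Longrightarrow> (\<And>x. R < norm x \<Longrightarrow> g x = 0) \<Longrightarrow>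
    \<exists>K\<ge>0. dominated k K (indicator (cball 0 R)) g"
proof (induction k arbitrary: g)
  case (0 g)
  then show ?case using compact_support_bounded[of g R] by auto
next
  case (Suc k g)
  have "\<exists>K\<ge>0. dominated k K (indicator (cball 0 R)) (partial b g)" for b
  proof (rule Suc.IH)
    show "Ck k (partial b g)" using Suc.prems by simp
    fix x :: 'a assume x: "R < norm x"
    have "partial b g x = partial b (\<lambda>_. 0) x"
    proof (rule partial_cong_open(2))
      show "open (- cball (0::'a) R)" by auto
    qed (use x Suc.prems in auto)
    then show "partial b g x = 0" by simp
  qed
  then obtain K where K: "\<And>b. 0 \<le> K b" "\<And>b. dominated k (K b) (indicator (cball 0 R)) (partial b g)"
    by metis
  have "\<exists>L\<ge>0. \<forall>x. \<bar>g x\<bar> \<le> L * indicator (cball 0 R) x"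
    using Ck_imp_continuous[OF Suc.prems(1)] Suc.prems(2) by (rule compact_support_bounded)
  then obtain L where L: "0 \<le> L" "\<And>x. \<bar>g x\<bar> \<le> L * indicator (cball 0 R) x" by auto
  define M where "M = L + (\<Sum>b\<in>Basis. K b)"
  have S: "K b \<le> (\<Sum>b\<in>Basis. K b)" if "b \<in> Basis" for b
    using that K(1) by (intro member_le_sum) auto
  have S0: "0 \<le> (\<Sum>b\<in>Basis. K b)" using K(1) by (simp add: sum_nonneg)
  have "dominated k M (indicator (cball 0 R)) (partial b g)" if "b \<in> Basis" for b
    using K(2)[of b] by (rule dominated_mono) (use S[OF that] L(1) in \<open>auto simp: M_def intro!: mult_right_mono\<close>)
  moreover have "\<bar>g x\<bar> \<le> M * indicator (cball 0 R) x" for x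
    using L(2)[of x] by (rule order_trans) (use S0 in \<open>auto simp: M_def intro!: mult_right_mono\<close>)
  ultimately show ?case using Suc.prems L(1) S0 by (intro exI[of _ M]) (auto simp: M_def)
qed

text \<open>The multiplier is bounded together with its derivatives up to order \<open>k + 1\<close>, uniformly in \<open>z\<close>. By
  the product rule for dominated functions these are at most a constant times
  \<open>\<rho>\<^sub>\<delta>(z) \<rho>\<^sub>-\<^sub>\<delta>(x)\<close> on the support of the cutoff, where \<open>weight_ratio_le\<close> applies.\<close>

lemma multiplier_holder_bounded:
  fixes \<eta> :: "'a::euclidean_space \<Rightarrow> real"
  assumes \<eta>: "is_cutoff \<eta>" and r: "0 < r" "r \<le> 1" and a: "0 \<le> a" "a \<le> 1"
  shows "\<exists>A\<ge>0. \<forall>z. holder_bounded k a A (\<lambda>x. weight \<delta> z * (local_cutoff \<eta> r z x * weight (- \<delta>) x))"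
proof -
  obtain K where K: "0 \<le> K" "dominated (Suc k) K (indicator (cball 0 (1/4))) \<eta>"
    using Ck_compact_support_dominated[of "Suc k" \<eta> "1/4"] \<eta> unfolding is_cutoff_def by blast
  obtain L where L: "dominated (Suc k) L (weight (- \<delta>)) (weight (- \<delta>) :: 'a \<Rightarrow> real)"
    using dominated_weight by blast
  have "0 \<le> L * weight (- \<delta>) (0::'a)" using dominated_abs_le[OF L] by (rule order_trans[OF abs_ge_zero])
  then have L0: "0 \<le> L" using weight_pos[of "- \<delta>" "0::'a"] by (simp add: zero_le_mult_iff)
  define S where "S = inverse r"
  have S1: "1 \<le> S" using r by (simp add: S_def one_le_inverse)
  define M where "M = 2 ^ Suc k * (S ^ Suc k * K * L)"
  have M0: "0 \<le> M" using K(1) L0 S1 by (simp add: M_def)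
  have "dominated (Suc k) (M * 4 powr \<bar>\<delta> / 2\<bar>) (\<lambda>_. 1)
      (\<lambda>x. weight \<delta> z * (local_cutoff \<eta> r z x * weight (- \<delta>) x))" for z
  proof (rule dominated_mono)
    define s where "s = inverse (r * (1 + norm z))"
    have "r * 1 \<le> r * (1 + norm z)" using r by (intro mult_left_mono) auto
    then have "r \<le> r * (1 + norm z)" by simp
    then have s: "0 < s" "s \<le> S"
      unfolding s_def S_def using r by (simp add: add_pos_nonneg, intro le_imp_inverse_le)
    have lc: "local_cutoff \<eta> r z = (\<lambda>x. \<eta> (s *\<^sub>R (x - z)))"
      by (simp add: local_cutoff_def s_def fun_eq_iff)
    show "dominated (Suc k) (\<bar>weight \<delta> z\<bar> * M)
        (\<lambda>x. indicator (cball 0 (1/4)) (s *\<^sub>R (x - z)) * weight (- \<delta>) x)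
        (\<lambda>x. weight \<delta> z * (local_cutoff \<eta> r z x * weight (- \<delta>) x))"
      unfolding M_def lc using s S1 by (intro dominated_cmult dominated_mult L dominated_rescale K(2)) auto
    show "\<bar>weight \<delta> z\<bar> * M * (indicator (cball 0 (1/4)) (s *\<^sub>R (x - z)) * weight (- \<delta>) x)
        \<le> M * 4 powr \<bar>\<delta> / 2\<bar> * 1" for x
    proof (cases "norm (s *\<^sub>R (x - z)) \<le> 1 / 4")
      case True
      then have "s * norm (x - z) \<le> 1 / 4" using s by simp
      then have "norm (x - z) \<le> r * (1 + norm z) / 4"
        using r by (simp add: s_def field_simps add_pos_nonneg)
      also have "\<dots> \<le> (1 + norm z) / 4" using r mult_right_mono[of r 1 "1 + norm z"] by simp
      finally have "M * (weight \<delta> z * weight (- \<delta>) x) \<le> M * 4 powr \<bar>\<delta> / 2\<bar>"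
        using M0 by (intro mult_left_mono weight_ratio_le)
      then show ?thesis using True weight_pos[of \<delta> z] by (simp add: ac_simps)
    next
      case False
      then show ?thesis using M0 by simp
    qed
  qed
  then have "\<forall>z. holder_bounded k a ((real DIM('a) + 2) * (M * 4 powr \<bar>\<delta> / 2\<bar>))
      (\<lambda>x. weight \<delta> z * (local_cutoff \<eta> r z x * weight (- \<delta>) x))"
    using dominated_imp_holder_bounded[OF a] by blast
  moreover have "0 \<le> (real DIM('a) + 2) * (M * 4 powr \<bar>\<delta> / 2\<bar>)" using M0 by simp
  ultimately show ?thesis by blast
qed


section \<open>Hoelder bounds and the Hoelder norm\<close>

lemma Ck_const: "Ck k (\<lambda>_. c)"
  by (induction k arbitrary: c) auto

lemma Ck_add: "Ck k g \<Longrightarrow> Ck k h \<Longrightarrow> Ck k (\<lambda>x. g x + h x)"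
  by (induction k arbitrary: g h) (auto intro!: continuous_intros simp: partial_add)

lemma Ck_cmult: "Ck k g \<Longrightarrow> Ck k (\<lambda>x. c * g x)"
  by (induction k arbitrary: g) (auto intro!: continuous_intros simp: partial_cmult)

lemma Ck_sum: "finite I \<Longrightarrow> (\<And>i. i \<in> I \<Longrightarrow> Ck k (g i)) \<Longrightarrow> Ck k (\<lambda>x. \<Sum>i\<in>I. g i x)"
  by (induction I rule: finite_induct) (auto intro: Ck_const Ck_add)

text \<open>\<open>Ck\<close> speaks about derivatives in all directions, \<open>holder_bounded\<close> about basis directions only;
  linearity of the derivative bridges the two.\<close>

lemma holder_bounded_imp_Ck: "holder_bounded k a K g \<Longrightarrow> Ck k g"
proof (induction k arbitrary: g)
  case 0
  then show ?case by simp
next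
  case (Suc k)
  have "Ck k (\<lambda>x. frechet_derivative g (at x) v)" for v
  proof -
    have "(\<lambda>x. frechet_derivative g (at x) v) = (\<lambda>x. \<Sum>b\<in>Basis. (v \<bullet> b) * partial b g x)"
      using Suc.prems by (intro ext frechet_derivative_expand) simp
    moreover have "Ck k (\<lambda>x. \<Sum>b\<in>Basis. (v \<bullet> b) * partial b g x)"
      using Suc by (intro Ck_sum Ck_cmult) auto
    ultimately show ?thesis by simp
  qed
  with Suc.prems show ?case by simp
qed

text \<open>\<open>iter_partial\<close> applies the head of the list last, whereas \<open>Ck\<close> and \<open>holder_bounded\<close> recurse on
  the derivative taken first. Inductions relating them therefore remove the last list element.\<close>

lemma iter_partial_snoc: "iter_partial (bs @ [b]) g = iter_partial bs (partial b g)"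
  by (induction bs) auto

lemma Ck_iter_partial: "Ck k g \<Longrightarrow> length bs \<le> k \<Longrightarrow> Ck (k - length bs) (iter_partial bs g)"
proof (induction bs arbitrary: g k rule: rev_induct)
  case Nil
  then show ?case by simp
next
  case (snoc b bs)
  then obtain l where "k = Suc l" by (cases k) auto
  with snoc show ?case by (simp add: iter_partial_snoc)
qed

lemma continuous_on_iter_partial:
  "Ck k g \<Longrightarrow> length bs \<le> k \<Longrightarrow> continuous_on UNIV (iter_partial bs g)"
  using Ck_iter_partial Ck_imp_continuous by blast

lemma holder_bounded_iff:
  "holder_bounded k a K g \<longleftrightarrow> Ck k g \<and>
    (\<forall>bs. set bs \<subseteq> Basis \<longrightarrow> length bs \<le> k \<longrightarrow> (\<forall>x. \<bar>iter_partial bs g x\<bar> \<le> K)) \<and>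
    (\<forall>bs. set bs \<subseteq> Basis \<longrightarrow> length bs = k \<longrightarrow>
      (\<forall>x y. \<bar>iter_partial bs g x - iter_partial bs g y\<bar> \<le> K * norm (x - y) powr a))"
  (is "_ \<longleftrightarrow> _ \<and> ?B k g \<and> ?H k g")
proof (induction k arbitrary: g)
  case 0
  then show ?case by auto
next
  case (Suc k)
  have snoc: "(\<forall>bs. set bs \<subseteq> Basis \<longrightarrow> P bs) \<longleftrightarrow>
      P [] \<and> (\<forall>b\<in>Basis. \<forall>bs. set bs \<subseteq> Basis \<longrightarrow> P (bs @ [b]))" for P :: "'a list \<Rightarrow> bool"
  proof (intro iffI allI impI)
    fix bs :: "'a list"
    assume "P [] \<and> (\<forall>b\<in>Basis. \<forall>bs. set bs \<subseteq> Basis \<longrightarrow> P (bs @ [b]))" "set bs \<subseteq> Basis"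
    then show "P bs" by (cases bs rule: rev_cases) auto
  qed auto
  have B: "?B (Suc k) g \<longleftrightarrow> (\<forall>x. \<bar>g x\<bar> \<le> K) \<and> (\<forall>b\<in>Basis. ?B k (partial b g))"
    by (subst snoc) (simp add: iter_partial_snoc)
  have H: "?H (Suc k) g \<longleftrightarrow> (\<forall>b\<in>Basis. ?H k (partial b g))"
    by (subst snoc) (simp add: iter_partial_snoc)
  have "holder_bounded (Suc k) a K g \<longleftrightarrow> Ck (Suc k) g \<and> holder_bounded (Suc k) a K g"
    using holder_bounded_imp_Ck by blast
  also have "\<dots> \<longleftrightarrow> Ck (Suc k) g \<and> ?B (Suc k) g \<and> ?H (Suc k) g"
    unfolding B H by (auto simp: Suc.IH)
  finally show ?case .
qed

lemma finite_tensor_idx: "finite (tensor_idx k :: 'a::euclidean_space list set)"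
  using finite_lists_length_eq[of "Basis :: 'a set" k] by (simp add: tensor_idx_def conj_commute)

text \<open>A Lebesgue null set has empty interior, so an almost everywhere bound on a continuous function
  holds everywhere.\<close>

lemma esssup_lborel_le_iff:
  fixes g :: "'a::euclidean_space \<Rightarrow> real"
  assumes g: "continuous_on UNIV g" and K: "0 \<le> K"
  shows "esssup lborel (\<lambda>x. ennreal (g x)) \<le> ennreal K \<longleftrightarrow> (\<forall>x. g x \<le> K)"
proof
  have m: "(\<lambda>x. ennreal (g x)) \<in> borel_measurable lborel"
    using borel_measurable_continuous_onI[OF g] by simp
  assume "esssup lborel (\<lambda>x. ennreal (g x)) \<le> ennreal K"
  then have "AE x in lborel. ennreal (g x) \<le> ennreal K"
    using esssup_AE[of "\<lambda>x. ennreal (g x)" lborel] by (auto elim!: eventually_mono)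
  then have "AE x in lborel. x \<in> {x. g x \<le> K}"
    using K by (auto elim!: eventually_mono simp: ennreal_le_iff)
  then have "AE x in lebesgue. x \<in> {x. g x \<le> K}" by (rule AE_completion)
  moreover have "closed {x. g x \<le> K}" using g by (intro closed_Collect_le) auto
  ultimately show "\<forall>x. g x \<le> K" using mem_closed_if_AE_lebesgue by blast
next
  assume "\<forall>x. g x \<le> K"
  then show "esssup lborel (\<lambda>x. ennreal (g x)) \<le> ennreal K"
    using borel_measurable_continuous_onI[OF g] by (intro esssup_I) (auto intro!: ennreal_leI)
qed

lemma continuous_on_norm_nabla: "Ck k g \<Longrightarrow> j \<le> k \<Longrightarrow> continuous_on UNIV (norm_nabla j g)"
  unfolding norm_nabla_def L2_set_def
  by (intro continuous_intros continuous_on_iter_partial[of k]) (auto simp: tensor_idx_def)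

lemma L2_set_le_card:
  assumes "\<And>i. i \<in> A \<Longrightarrow> \<bar>f i\<bar> \<le> K"
  shows "L2_set f A \<le> real (card A) * K"
proof -
  have "L2_set f A \<le> (\<Sum>i\<in>A. \<bar>f i\<bar>)" by (rule L2_set_le_sum_abs)
  also have "\<dots> \<le> real (card A) * K" using assms by (intro sum_bounded_above) auto
  finally show ?thesis .
qed

lemma abs_le_L2_set: "finite A \<Longrightarrow> i \<in> A \<Longrightarrow> \<bar>f i\<bar> \<le> L2_set f A"
  using member_le_L2_set[of A i "\<lambda>i. \<bar>f i\<bar>"] by (simp add: L2_set_def)

text \<open>Every entry of a tensor is bounded by its Frobenius norm, so no constant is lost here; in the
  converse estimate \<open>holder_bounded_imp_holder_norm_le\<close> the number of entries appears.\<close>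

lemma holder_norm_le_imp_holder_bounded:
  fixes g :: "'a::euclidean_space \<Rightarrow> real"
  assumes "holder_norm \<alpha> g \<le> ennreal K" "0 \<le> K"
  shows "holder_bounded (nat \<lfloor>\<alpha>\<rfloor>) (frac \<alpha>) K g"
proof -
  define k a where "k = nat \<lfloor>\<alpha>\<rfloor>" and "a = frac \<alpha>"
  define E where "E j = esssup lborel (\<lambda>x. ennreal (norm_nabla j g x))" for j
  define H where "H = (SUP (x, y) \<in> {(x, y). x \<noteq> y}. ennreal (dist_nabla k g x y / norm (x - y) powr a))"
  have C: "Ck k g" and le: "(\<Sum>j\<le>k. E j) + H \<le> ennreal K"
    using assms(1) unfolding holder_norm_def Let_def k_def[symmetric] a_def[symmetric] E_def[symmetric] H_def[symmetric]
    by (auto split: if_splits simp: top_unique)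
  have "\<bar>iter_partial bs g x\<bar> \<le> K" if bs: "set bs \<subseteq> Basis" "length bs \<le> k" for bs x
  proof -
    have "E (length bs) \<le> (\<Sum>j\<le>k. E j)" using bs by (intro member_le_sum) auto
    also have "\<dots> \<le> (\<Sum>j\<le>k. E j) + H" by simp
    also note le
    finally have "norm_nabla (length bs) g x \<le> K"
      unfolding E_def using esssup_lborel_le_iff continuous_on_norm_nabla[OF C bs(2)] assms(2) by blast
    moreover have "\<bar>iter_partial bs g x\<bar> \<le> norm_nabla (length bs) g x"
      unfolding norm_nabla_def using bs
      by (intro abs_le_L2_set[where f = "\<lambda>bs. iter_partial bs g x"] finite_tensor_idx) (simp add: tensor_idx_def)
    ultimately show ?thesis by linarith
  qed
  moreover have "\<bar>iter_partial bs g x - iter_partial bs g y\<bar> \<le> K * norm (x - y) powr a"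
    if bs: "set bs \<subseteq> Basis" "length bs = k" for bs x y
  proof (cases "x = y")
    case False
    have "ennreal (dist_nabla k g x y / norm (x - y) powr a) \<le> H"
      unfolding H_def using False by (intro SUP_upper2[of "(x, y)"]) auto
    also have "\<dots> \<le> (\<Sum>j\<le>k. E j) + H" by simp
    also note le
    finally have "dist_nabla k g x y \<le> K * norm (x - y) powr a"
      using False assms(2) by (simp add: ennreal_le_iff divide_le_eq)
    moreover have "\<bar>iter_partial bs g x - iter_partial bs g y\<bar> \<le> dist_nabla k g x y"
      unfolding dist_nabla_def using bs
      by (intro abs_le_L2_set[where f = "\<lambda>bs. iter_partial bs g x - iter_partial bs g y"] finite_tensor_idx)
        (simp add: tensor_idx_def)
    ultimately show ?thesis by linarith
  qed simp
  ultimately show ?thesis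
    unfolding k_def[symmetric] a_def[symmetric] holder_bounded_iff using C by blast
qed

lemma holder_bounded_imp_holder_norm_le:
  fixes g :: "'a::euclidean_space \<Rightarrow> real"
  assumes hb: "holder_bounded k a K g" and k: "k = nat \<lfloor>\<alpha>\<rfloor>" and a: "a = frac \<alpha>"
  shows "holder_norm \<alpha> g \<le> ennreal (((\<Sum>j\<le>k. real (card (tensor_idx j :: 'a list set)))
    + real (card (tensor_idx k :: 'a list set))) * K)"
proof -
  define c where "c j = real (card (tensor_idx j :: 'a list set))" for j
  have c0: "0 \<le> c j" for j by (simp add: c_def)
  have K: "0 \<le> K" using hb by (rule holder_bounded_nonneg)
  have C: "Ck k g" using hb by (rule holder_bounded_imp_Ck)
  have E: "esssup lborel (\<lambda>x. ennreal (norm_nabla j g x)) \<le> ennreal (c j * K)" if "j \<le> k" for j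
  proof -
    have "norm_nabla j g x \<le> c j * K" for x
      unfolding norm_nabla_def c_def
      using hb that by (intro L2_set_le_card) (auto simp: holder_bounded_iff tensor_idx_def)
    then show ?thesis
      using esssup_lborel_le_iff[OF continuous_on_norm_nabla[OF C that]] K c0 by simp
  qed
  have H: "(SUP (x, y) \<in> {(x, y). x \<noteq> y}. ennreal (dist_nabla k g x y / norm (x - y) powr a)) \<le> ennreal (c k * K)"
  proof (rule SUP_least, clarify)
    fix x y :: 'a assume xy: "x \<noteq> y"
    have "dist_nabla k g x y \<le> c k * (K * norm (x - y) powr a)"
      unfolding dist_nabla_def c_def
      using hb by (intro L2_set_le_card) (auto simp: holder_bounded_iff tensor_idx_def)
    then show "ennreal (dist_nabla k g x y / norm (x - y) powr a) \<le> ennreal (c k * K)"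
      using xy by (intro ennreal_leI) (simp add: divide_le_eq mult.assoc)
  qed
  have "holder_norm \<alpha> g \<le> (\<Sum>j\<le>k. ennreal (c j * K)) + ennreal (c k * K)"
    unfolding holder_norm_def Let_def k[symmetric] a[symmetric] using C E H by (auto intro!: add_mono sum_mono)
  also have "\<dots> = ennreal (((\<Sum>j\<le>k. c j) + c k) * K)"
    using K c0 by (simp add: sum_ennreal ennreal_plus[symmetric] sum_nonneg distrib_right sum_distrib_right del: ennreal_plus)
  finally show ?thesis unfolding c_def .
qed


section \<open>Localisation of the weighted norm\<close>

lemma local_cutoff_eq_one:
  assumes \<eta>: "is_cutoff \<eta>" and "0 < r" and "norm (x - z) \<le> r * (1 + norm z) / 8"
  shows "local_cutoff \<eta> r z x = 1"
proof -
  have pos: "0 < r * (1 + norm z)" using assms(2) by (simp add: add_pos_nonneg)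
  have "norm ((x - z) /\<^sub>R (r * (1 + norm z))) = norm (x - z) / (r * (1 + norm z))"
    using pos by (simp only: norm_scaleR abs_inverse abs_of_pos divide_inverse mult.commute)
  also have "\<dots> \<le> 1 / 8" using assms(3) pos by (simp add: pos_divide_le_eq)
  finally show ?thesis using \<eta> unfolding is_cutoff_def local_cutoff_def by blast
qed

theorem lemma3p8:
  fixes \<eta> :: "'a::euclidean_space \<Rightarrow> real" and \<alpha> r \<delta> \<kappa> :: real
  assumes "is_cutoff \<eta>" and "\<alpha> \<ge> 0" and "0 < r" and "r \<le> 1"
  shows "\<exists>C::real. C \<ge> 1 \<and> (\<forall>f :: 'a \<Rightarrow> real.
    ennreal (inverse C) *
      (SUP z. ennreal (weight \<delta> z) *
         weighted_holder_norm \<alpha> (weight \<kappa>) (\<lambda>x. local_cutoff \<eta> r z x * f x))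
      \<le> weighted_holder_norm \<alpha> (\<lambda>x. weight \<delta> x * weight \<kappa> x) f \<and>
    weighted_holder_norm \<alpha> (\<lambda>x. weight \<delta> x * weight \<kappa> x) f
      \<le> ennreal C *
        (SUP z. ennreal (weight \<delta> z) *
           weighted_holder_norm \<alpha> (weight \<kappa>) (\<lambda>x. local_cutoff \<eta> r z x * f x)))"
proof -
  define k a where k: "k = nat \<lfloor>\<alpha>\<rfloor>" and a: "a = frac \<alpha>"
  have a01: "0 \<le> a" "a \<le> 1" unfolding a using frac_lt_1[of \<alpha>] by (auto simp: less_imp_le)
  define m where "m \<delta> r z = (\<lambda>x. weight \<delta> z * (local_cutoff \<eta> r z x * weight (- \<delta>) x))" for \<delta> r z
  obtain A where A: "0 \<le> A" "\<And>z. holder_bounded k a A (m \<delta> r z)"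
    using multiplier_holder_bounded[OF assms(1,3,4) a01] unfolding m_def by blast
  have r2: "0 < r / 2" "r / 2 \<le> 1" using assms(3,4) by auto
  obtain B where B: "0 \<le> B" "\<And>z. holder_bounded k a B (m (- \<delta>) (r / 2) z)"
    using multiplier_holder_bounded[OF assms(1) r2 a01] unfolding m_def by blast
  define N where "N = (\<Sum>j\<le>k. real (card (tensor_idx j :: 'a list set))) + real (card (tensor_idx k :: 'a list set))"
  define P where "P = 2 * (2 * (real DIM('a) + 2)) ^ k"
  define Q where "Q = 1 + 2 / (r / 16) powr a"
  define C where "C = 1 + N * (P * A) + N * (Q * (P * B))"
  have N0: "0 \<le> N" by (simp add: N_def sum_nonneg)
  have P0: "0 \<le> P" by (simp add: P_def)
  have Q0: "0 \<le> Q" by (simp add: Q_def)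
  have C: "1 \<le> C" "N * (P * A) \<le> C" "N * (Q * (P * B)) \<le> C"
    using A(1) B(1) N0 P0 Q0 by (simp_all add: C_def)
  have norm_le: "holder_norm \<alpha> g \<le> ennreal (N * K)" if "holder_bounded k a K g" for K and g :: "'a \<Rightarrow> real"
    using holder_bounded_imp_holder_norm_le[OF that k a] unfolding N_def .
  have le_norm: "holder_bounded k a K g" if "holder_norm \<alpha> g \<le> ennreal K" "0 \<le> K" for K and g :: "'a \<Rightarrow> real"
    using holder_norm_le_imp_holder_bounded[OF that] unfolding k a .
  have mult: "holder_bounded k a (P * (K * L)) (\<lambda>x. g x * h x)"
    if "holder_bounded k a K g" "holder_bounded k a L h" for K L and g h :: "'a \<Rightarrow> real"
    using holder_bounded_mult[OF a01 that] unfolding P_def .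
  have inv: "weight (- \<delta>) x * weight \<delta> x = 1" for x :: 'a by (simp add: weight_mult weight_zero)
  show ?thesis
  proof (intro exI[of _ C] conjI allI C(1))
    fix f :: "'a \<Rightarrow> real"
    define F where "F = (\<lambda>x. weight \<delta> x * weight \<kappa> x * f x)"
    define G where "G z = (\<lambda>x. weight \<kappa> x * (local_cutoff \<eta> r z x * f x))" for z
    define S where "S = (SUP z. ennreal (weight \<delta> z) * holder_norm \<alpha> (G z))"
    \<comment> \<open>\<open>m \<delta> r z F = \<rho>\<^sub>\<delta>(z) G\<^sub>z\<close>, and the factor \<open>\<rho>\<^sub>\<delta>(z)\<close> is divided out and restored because it stands
      outside the norm\<close>
    have lower: "S \<le> ennreal C * holder_norm \<alpha> F"
    proof (cases "holder_norm \<alpha> F")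
      case top
      then show ?thesis using C(1) by (simp add: ennreal_mult_top)
    next
      case (real K)
      then have F: "holder_bounded k a K F" by (intro le_norm) auto
      show ?thesis unfolding S_def
      proof (rule SUP_least)
        fix z :: 'a
        have w: "0 < weight \<delta> z" by (rule weight_pos)
        have "m \<delta> r z x * F x = weight \<delta> z * G z x" for x
        proof -
          have "m \<delta> r z x * F x = (weight (- \<delta>) x * weight \<delta> x) * (weight \<delta> z * G z x)"
            unfolding m_def F_def G_def by (simp only: ac_simps)
          then show ?thesis unfolding inv by simp
        qed
        then have "holder_bounded k a (P * (A * K)) (\<lambda>x. weight \<delta> z * G z x)"
          using mult[OF A(2)[of z] F] by (simp only:)
        then have "holder_bounded k a (\<bar>inverse (weight \<delta> z)\<bar> * (P * (A * K)))
            (\<lambda>x. inverse (weight \<delta> z) * (weight \<delta> z * G z x))"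
          by (rule holder_bounded_cmult)
        then have "holder_norm \<alpha> (G z) \<le> ennreal (N * (inverse (weight \<delta> z) * (P * (A * K))))"
          using w by (intro norm_le) (simp add: mult.assoc[symmetric])
        then have "ennreal (weight \<delta> z) * holder_norm \<alpha> (G z)
            \<le> ennreal (weight \<delta> z) * ennreal (N * (inverse (weight \<delta> z) * (P * (A * K))))"
          by (intro mult_left_mono) auto
        also have "\<dots> = ennreal (N * (P * A) * K)"
          using w by (simp add: ennreal_mult'[symmetric] field_simps)
        also have "\<dots> \<le> ennreal (C * K)" using C(2) real by (intro ennreal_leI mult_right_mono) auto
        also have "\<dots> = ennreal C * holder_norm \<alpha> F" using C(1) real by (simp add: ennreal_mult')
        finally show "ennreal (weight \<delta> z) * holder_norm \<alpha> (G z) \<le> ennreal C * holder_norm \<alpha> F" .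
      qed
    qed
    \<comment> \<open>the radius \<open>r/16\<close> is the smallest, over all \<open>z\<close>, of the radii \<open>(r/2) (1 + |z|)/8\<close> of the balls
      on which the narrower cutoff equals 1\<close>
    have upper: "holder_norm \<alpha> F \<le> ennreal C * S"
    proof (cases S)
      case top
      then show ?thesis using C(1) by (simp add: ennreal_mult_top)
    next
      case (real K)
      have "holder_bounded k a (Q * (P * (B * K))) F"
        unfolding Q_def
      proof (rule holder_bounded_local[OF a01(1)])
        show "0 < r / 16" using assms(3) by simp
        fix z :: 'a
        have w: "0 < weight \<delta> z" by (rule weight_pos)
        have "holder_norm \<alpha> (G z) = ennreal (inverse (weight \<delta> z)) * (ennreal (weight \<delta> z) * holder_norm \<alpha> (G z))"
          using w by (simp add: mult.assoc[symmetric] ennreal_mult'[symmetric])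
        also have "\<dots> \<le> ennreal (inverse (weight \<delta> z)) * ennreal K"
          unfolding real(2)[symmetric] S_def by (intro mult_left_mono SUP_upper) auto
        also have "\<dots> = ennreal (inverse (weight \<delta> z) * K)"
          using w by (simp add: ennreal_mult')
        finally have "holder_bounded k a (inverse (weight \<delta> z) * K) (G z)"
          using w real(1) by (intro le_norm) auto
        then have "holder_bounded k a (\<bar>weight \<delta> z\<bar> * (inverse (weight \<delta> z) * K)) (\<lambda>x. weight \<delta> z * G z x)"
          by (rule holder_bounded_cmult)
        then have "holder_bounded k a K (\<lambda>x. weight \<delta> z * G z x)"
          using w by (simp add: mult.assoc[symmetric])
        then have "holder_bounded k a (P * (B * K)) (\<lambda>x. m (- \<delta>) (r / 2) z x * (weight \<delta> z * G z x))"
          by (rule mult[OF B(2)])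
        moreover have "m (- \<delta>) (r / 2) z x * (weight \<delta> z * G z x) = F x" if "x \<in> ball z (r / 16)" for x
        proof -
          have "norm (x - z) \<le> r / 16" using that by (simp add: dist_norm norm_minus_commute)
          also have "\<dots> \<le> r / 2 * (1 + norm z) / 8" using assms(3) by simp
          finally have le: "norm (x - z) \<le> r / 2 * (1 + norm z) / 8" .
          have "0 \<le> r * (1 + norm z)" using assms(3) by simp
          with le have le': "norm (x - z) \<le> r * (1 + norm z) / 8" by simp
          have "m (- \<delta>) (r / 2) z x * (weight \<delta> z * G z x)
              = (weight (- \<delta>) z * weight \<delta> z) * (local_cutoff \<eta> (r / 2) z x * local_cutoff \<eta> r z x) * F x"
            unfolding m_def F_def G_def by (simp only: ac_simps minus_minus)
          then show ?thesis
            unfolding inv local_cutoff_eq_one[OF assms(1) r2(1) le] local_cutoff_eq_one[OF assms(1,3) le'] by simp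
        qed
        ultimately show "\<exists>H. holder_bounded k a (P * (B * K)) H \<and> (\<forall>x\<in>ball z (r / 16). H x = F x)"
          by blast
      qed
      then have "holder_norm \<alpha> F \<le> ennreal (N * (Q * (P * (B * K))))" by (rule norm_le)
      also have "\<dots> = ennreal (N * (Q * (P * B)) * K)" by (simp only: ac_simps)
      also have "\<dots> \<le> ennreal (C * K)" using C(3) real by (intro ennreal_leI mult_right_mono) auto
      also have "\<dots> = ennreal C * S" using C(1) real by (simp add: ennreal_mult')
      finally show ?thesis .
    qed
    have S: "(SUP z. ennreal (weight \<delta> z) *
        weighted_holder_norm \<alpha> (weight \<kappa>) (\<lambda>x. local_cutoff \<eta> r z x * f x)) = S"
      by (simp only: S_def G_def weighted_holder_norm_def)
    have F: "weighted_holder_norm \<alpha> (\<lambda>x. weight \<delta> x * weight \<kappa> x) f = holder_norm \<alpha> F"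
      by (simp only: F_def weighted_holder_norm_def)
    have "ennreal (inverse C) * S \<le> ennreal (inverse C) * (ennreal C * holder_norm \<alpha> F)"
      using lower by (intro mult_left_mono) auto
    also have "\<dots> = holder_norm \<alpha> F"
      using C(1) by (simp add: mult.assoc[symmetric] ennreal_mult'[symmetric])
    finally show "ennreal (inverse C) * (SUP z. ennreal (weight \<delta> z) *
        weighted_holder_norm \<alpha> (weight \<kappa>) (\<lambda>x. local_cutoff \<eta> r z x * f x))
      \<le> weighted_holder_norm \<alpha> (\<lambda>x. weight \<delta> x * weight \<kappa> x) f"
      unfolding S F .
    show "weighted_holder_norm \<alpha> (\<lambda>x. weight \<delta> x * weight \<kappa> x) f \<le> ennreal C * (SUP z. ennreal (weight \<delta> z) *
        weighted_holder_norm \<alpha> (weight \<kappa>) (\<lambda>x. local_cutoff \<eta> r z x * f x))"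
      unfolding S F by (rule upper)
  qed
qed

end
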